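(* Let $s \in (0,1)$ and $\rho > 2$ be real numbers, and let $f(n)$ be a nonnegative real-valued function of the positive integer $n$. Suppose that $\rho \frac{\log(sn)}{sn} \leq f(n) \leq 1/2$ for all large enough $n$. Then the random XOR-formula $Q^{f(n)}(n, sn)$ is with high probability $\Omega(n)$-separated; that is, there exists a function $g(n) \in \Omega(n)$ such that $\lim_{n\to\infty} \Pr[Q^{f(n)}(n, sn) \text{ is } g(n)\text{-separated}] = 1$.
   Context: Let $X_1, \dots, X_n$ be propositional variables. An XOR-clause over $n$ variables is the exclusive-or of exactly one of the constants $0$ or $1$ together with a subset of the variables $X_1,\dots,X_n$; if it includes the constant $0$ (respectively $1$), it evaluates to true under a truth assignment if and only if an odd (respectively even) number of its included variables evaluate to true. A random XOR-clause with variable-probability $p \in [0,1]$ is obtained by including each $X_i$ independently with probability $p$, and (independently) including the constant $1$ with probability $1/2$ and the constant $0$ otherwise. For a positive integer $n$, a nonnegative real $s$, and $p\in[0,1]$, $Q^{p}(n, sn)$ denotes the random formula that is the conjunction of $\lceil sn \rceil$ independently chosen random XOR-clauses over $n$ variables with variable-probability $p$. When $p = f(n)$ depends on $n$, only those (large enough) $n$ with $f(n)\in[0,1]$ matter. A solution of a formula is a truth assignment to $X_1,\dots,X_n$ under which the formula evaluates to true. For a real number $d$, a formula is $d$-separated if the Hamming distance between every pair of distinct solutions is at least $d$ (vacuously true if there are fewer than two solutions). $g(n)\in\Omega(n)$ means there is a constant $c>0$ with $g(n)\ge cn$ for all sufficiently large $n$. A sequence of events $E_n$ occurs with high probability if $\Pr[E_n]\to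 1$ as $n\to\infty$. Here $\log$ is the natural logarithm. *)

theory Defs
  imports "HOL-Probability.Probability"
begin

text \<open>
  The variables are $X_1, \dots, X_n$, represented by their indices. A clause consists of its
  constant (\<open>True\<close> for $1$, \<open>False\<close> for $0$) and the set of its variables; a formula is the
  conjunction of a list of clauses, which may contain repetitions.
\<close>

type_synonym xor_clause = "bool \<times> nat set"
type_synonym xor_formula = "xor_clause list"

fun sat_clause :: "(nat \<Rightarrow> bool) \<Rightarrow> xor_clause \<Rightarrow> bool" where
  "sat_clause a (c, V) \<longleftrightarrow> (if c then even (card {i \<in> V. a i}) else odd (card {i \<in> V. a i}))"

text \<open>
  Assignments are extensional functions on \<open>{1..n}\<close>, so distinct assignments differ on
  one of the \<open>n\<close> variables.
\<close>

definition assignments :: "nat \<Rightarrow> (nat \<Rightarrow> bool) set" where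
  "assignments n = ({1..n} \<rightarrow>\<^sub>E UNIV)"

definition solutions :: "nat \<Rightarrow> xor_formula \<Rightarrow> (nat \<Rightarrow> bool) set" where
  "solutions n F = {a \<in> assignments n. \<forall>C \<in> set F. sat_clause a C}"

definition hamming_dist :: "nat \<Rightarrow> (nat \<Rightarrow> bool) \<Rightarrow> (nat \<Rightarrow> bool) \<Rightarrow> nat" where
  "hamming_dist n a b = card {i \<in> {1..n}. a i \<noteq> b i}"

definition separated :: "nat \<Rightarrow> real \<Rightarrow> xor_formula \<Rightarrow> bool" where
  "separated n d F \<longleftrightarrow>
     (\<forall>a \<in> solutions n F. \<forall>b \<in> solutions n F. a \<noteq> b \<longrightarrow> d \<le> real (hamming_dist n a b))"

text \<open>
  The library's \<open>bernoulli_pmf p\<close> clamps \<open>p\<close> to \<open>[0,1]\<close>, so the following distributions carry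
  their intended meaning only for \<open>p\<close> in \<open>[0,1]\<close>.
\<close>

definition random_var_set :: "real \<Rightarrow> nat \<Rightarrow> nat set pmf" where
  "random_var_set p n =
     map_pmf (\<lambda>incl. {i \<in> {1..n}. incl i}) (Pi_pmf {1..n} False (\<lambda>_. bernoulli_pmf p))"

definition random_xor_clause :: "real \<Rightarrow> nat \<Rightarrow> xor_clause pmf" where
  "random_xor_clause p n = pair_pmf (bernoulli_pmf (1/2)) (random_var_set p n)"

text \<open>\<open>random_xor_formula p n x\<close> is $Q^p(n, x)$, with $\lceil x \rceil$ independent clauses.\<close>

definition random_xor_formula :: "real \<Rightarrow> nat \<Rightarrow> real \<Rightarrow> xor_formula pmf" where
  "random_xor_formula p n x = replicate_pmf (nat \<lceil>x\<rceil>) (random_xor_clause p n)"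

text \<open>
  Linear lower bounds are one-sided here. The library's \<open>g \<in> \<Omega>(\<lambda>n. real n)\<close> only bounds
  \<open>\<bar>g n\<bar>\<close> from below and so would admit negative \<open>g\<close>.
\<close>

definition linear_lower_bound :: "(nat \<Rightarrow> real) \<Rightarrow> bool" where
  "linear_lower_bound g \<longleftrightarrow> (\<exists>c>0. \<forall>\<^sub>F n in sequentially. g n \<ge> c * real n)"

end

theory Submission
  imports Defs "HOL-Real_Asymp.Real_Asymp"
begin

text \<open>
  Two distinct solutions differ on a nonempty set \<open>D\<close> that meets the variable set of every
  clause evenly. A random clause meets \<open>D\<close> evenly with probability
  $(1 + (1-2p)^{|D|})/2$, so a first-moment bound over all \<open>D\<close> with $1 \le |D| < cn$ suffices.
  If $2p|D| \le 1$, all $m = \lceil sn \rceil$ clauses do so with probability at most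
  $e^{-pm|D|/2} \le (sn)^{-\rho|D|/2}$, and these terms sum to $o(1)$ because $\rho > 2$.
  Otherwise the probability is at most $(3/4)^m$, which for small \<open>c\<close> beats
  the number of sets with $|D| < cn$.
\<close>

section \<open>Parity of random intersections\<close>

lemma prob_Collect_eq_pmf_map: "measure_pmf.prob M {x. Q x} = pmf (map_pmf Q M) True"
  by (simp add: pmf_map vimage_def)

lemma pmf_map_not: "pmf (map_pmf (\<lambda>x. \<not> Q x) M) True = 1 - pmf (map_pmf Q M) True"
proof -
  have "pmf (map_pmf (\<lambda>x. \<not> Q x) M) True = measure_pmf.prob M (UNIV - {x. Q x})"
    by (simp add: prob_Collect_eq_pmf_map[symmetric] Compl_eq_Diff_UNIV[symmetric] Collect_neg_eq)
  then show ?thesis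
    using measure_pmf.prob_compl[of "{x. Q x}" M] by (simp add: prob_Collect_eq_pmf_map)
qed

text \<open>Each new element flips the parity with probability \<open>p\<close>, so the probability
  q of evenness becomes p(1 - q) + (1 - p)q. Hence the bias 2q - 1, initially 1, is multiplied by 1
  - 2p at every step.\<close>

lemma prob_Pi_bernoulli_even:
  assumes "finite D" "0 \<le> p" "p \<le> 1"
  shows "measure_pmf.prob (Pi_pmf D False (\<lambda>_. bernoulli_pmf p)) {h. even (card {i\<in>D. h i})}
           = (1 + (1 - 2 * p) ^ card D) / 2"
  using assms(1)
proof (induction rule: finite_induct)
  case empty
  then show ?case by simp
next
  case (insert x D)
  let ?M = "Pi_pmf D False (\<lambda>_. bernoulli_pmf p)"
  let ?Q = "\<lambda>h. even (card {i\<in>D. h i})"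
  have parity: "even (card {i \<in> insert x D. (h(x := b)) i}) \<longleftrightarrow> (if b then \<not> ?Q h else ?Q h)"
    for h b
  proof -
    have "{i \<in> insert x D. (h(x := b)) i} = (if b then insert x {i\<in>D. h i} else {i\<in>D. h i})"
      using insert.hyps by auto
    then show ?thesis
      using insert.hyps by simp
  qed
  have "measure_pmf.prob (Pi_pmf (insert x D) False (\<lambda>_. bernoulli_pmf p))
          {h. even (card {i \<in> insert x D. h i})}
        = pmf (bernoulli_pmf p \<bind> (\<lambda>b. map_pmf (\<lambda>h. if b then \<not> ?Q h else ?Q h) ?M)) True"
    unfolding prob_Collect_eq_pmf_map Pi_pmf_insert'[OF insert.hyps] map_bind_pmf
    by (simp only: map_bind_pmf map_return_pmf bind_return_pmf parity map_pmf_def)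
  also have "\<dots> = p * (1 - pmf (map_pmf ?Q ?M) True) + (1 - p) * pmf (map_pmf ?Q ?M) True"
    using assms by (simp add: pmf_bind pmf_map_not)
  also have "\<dots> = (1 + (1 - 2 * p) ^ card (insert x D)) / 2"
    using insert by (simp add: prob_Collect_eq_pmf_map field_simps)
  finally show ?case .
qed

lemma prob_clause_even:
  assumes "D \<subseteq> {1..n}" "0 \<le> p" "p \<le> 1"
  shows "measure_pmf.prob (random_xor_clause p n) {C. even (card (snd C \<inter> D))}
           = (1 + (1 - 2 * p) ^ card D) / 2"
proof -
  have D: "finite D" using assms(1) finite_subset by blast
  have "map_pmf (\<lambda>C. even (card (snd C \<inter> D))) (random_xor_clause p n)
      = map_pmf (\<lambda>V. even (card (V \<inter> D))) (map_pmf snd (random_xor_clause p n))"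
    by (simp add: map_pmf_comp)
  also have "\<dots> = map_pmf (\<lambda>h. even (card ({i\<in>{1..n}. h i} \<inter> D)))
                    (Pi_pmf {1..n} False (\<lambda>_. bernoulli_pmf p))"
    by (simp add: random_xor_clause_def map_snd_pair_pmf random_var_set_def map_pmf_comp)
  \<comment> \<open>Resetting the coordinates outside \<open>D\<close> to the default
    \<open>False\<close> is the form in which \<open>Pi_pmf_subset\<close> expresses the marginal on
    \<open>D\<close>.\<close>
  also have "(\<lambda>h. even (card ({i\<in>{1..n}. h i} \<inter> D))) =
      (\<lambda>h. even (card {i\<in>D. h i})) \<circ> (\<lambda>h i. if i \<in> D then h i else False)"
  proof
    fix h :: "nat \<Rightarrow> bool"
    have "{i\<in>{1..n}. h i} \<inter> D = {i\<in>D. if i \<in> D then h i else False}"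
      using assms(1) by auto
    then show "even (card ({i\<in>{1..n}. h i} \<inter> D)) =
      ((\<lambda>h. even (card {i\<in>D. h i})) \<circ> (\<lambda>h i. if i \<in> D then h i else False)) h"
      by (simp only: o_apply)
  qed
  also have "map_pmf \<dots> (Pi_pmf {1..n} False (\<lambda>_. bernoulli_pmf p))
      = map_pmf (\<lambda>h. even (card {i\<in>D. h i})) (Pi_pmf D False (\<lambda>_. bernoulli_pmf p))"
    using assms(1) by (simp only: pmf.map_comp[symmetric] Pi_pmf_subset[OF finite_atLeastAtMost assms(1)])
  finally show ?thesis
    using prob_Pi_bernoulli_even[OF D assms(2,3)] by (simp add: prob_Collect_eq_pmf_map)
qed

lemma prob_replicate_pmf_all:
  "measure_pmf.prob (replicate_pmf m P) {xs. \<forall>x\<in>set xs. Q x} = measure_pmf.prob P {x. Q x} ^ m"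
proof (induction m)
  case 0
  then show ?case by simp
next
  case (Suc m)
  have "replicate_pmf (Suc m) P = map_pmf (\<lambda>(x, xs). x # xs) (pair_pmf P (replicate_pmf m P))"
    by (simp add: pair_pmf_def map_pmf_def bind_assoc_pmf bind_return_pmf)
  then have "map_pmf (\<lambda>xs. \<forall>x\<in>set xs. Q x) (replicate_pmf (Suc m) P)
      = map_pmf (\<lambda>(a, b). a \<and> b)
          (pair_pmf (map_pmf Q P) (map_pmf (\<lambda>xs. \<forall>x\<in>set xs. Q x) (replicate_pmf m P)))"
    by (simp add: pair_map_pmf1 pair_map_pmf2 map_pmf_comp case_prod_unfold)
  also have "pmf \<dots> True
      = pmf (map_pmf Q P) True * pmf (map_pmf (\<lambda>xs. \<forall>x\<in>set xs. Q x) (replicate_pmf m P)) True"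
  proof -
    have "(\<lambda>(a, b). a \<and> b) -` {True} = {(True, True)}" by auto
    then show ?thesis
      unfolding pmf_map[of "\<lambda>(a, b). a \<and> b"] by (simp only: measure_pmf_single pmf_pair)
  qed
  finally show ?case
    using Suc unfolding prob_Collect_eq_pmf_map by simp
qed

section \<open>First-moment bound for close pairs of solutions\<close>

lemma sum_Pow_power_card:
  fixes x :: "'a::comm_ring_1"
  assumes "finite A"
  shows "(\<Sum>D\<in>Pow A. x ^ card D) = (1 + x) ^ card A"
  using prod_add[OF assms, of "\<lambda>_. x" "\<lambda>_. 1"] by (simp add: add.commute)

text \<open>The cardinality of a symmetric difference is |A| + |B| - 2|A \<inter> B|.\<close>

lemma even_card_neq:
  assumes "finite V"
  assumes "even (card {i\<in>V. a i}) \<longleftrightarrow> even (card {i\<in>V. b i})"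
  shows "even (card {i\<in>V. a i \<noteq> b i})"
proof -
  let ?A = "{i\<in>V. a i}" and ?B = "{i\<in>V. b i}"
  have fin: "finite ?A" "finite ?B" using assms(1) by auto
  have "{i\<in>V. a i \<noteq> b i} = (?A - ?B) \<union> (?B - ?A)" by auto
  then have "card {i\<in>V. a i \<noteq> b i} = card (?A - ?B) + card (?B - ?A)"
    using fin by (simp only:) (rule card_Un_disjoint; blast)
  moreover have "card ?A = card (?A \<inter> ?B) + card (?A - ?B)"
    by (rule card_Int_Diff[OF fin(1)])
  moreover have "card ?B = card (?A \<inter> ?B) + card (?B - ?A)"
    using card_Int_Diff[OF fin(2), of ?A] by (simp only: Int_commute)
  ultimately show ?thesis
    using assms(2) by (simp only: even_add) blast
qed

text \<open>The sum on the right replaces a case distinction on 2pw, so the union bound need not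
  separate small from large sets. The first term is a power with exponent \<open>w\<close>, so that
  summing it over subsets gives a product.\<close>

lemma even_prob_bound:
  fixes p :: real
  assumes "0 \<le> p" "p \<le> 1/2"
  shows "((1 + (1 - 2 * p) ^ w) / 2) ^ m \<le> exp (- (p * m / 2)) ^ w + (3/4) ^ m"
proof -
  let ?b = "(1 + (1 - 2 * p) ^ w) / 2"
  let ?x = "2 * p * w"
  have b0: "0 \<le> ?b" using assms by simp
  \<comment> \<open>The rational bound 1/(1 + x) on e^(-x) serves both cases: it is at most 1 - x/2
    for 0 \<le> x \<le> 1 and at most 1/2 for x > 1.\<close>
  have "(1 - 2 * p) ^ w \<le> exp (- (2 * p)) ^ w"
    using assms exp_ge_add_one_self[of "- (2 * p)"] by (intro power_mono) auto
  also have "\<dots> = exp (- ?x)"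
    by (simp add: exp_of_nat_mult[symmetric] mult_ac)
  also have "\<dots> \<le> 1 / (1 + ?x)"
    using exp_ge_add_one_self[of ?x] assms unfolding exp_minus inverse_eq_divide
    by (intro divide_left_mono mult_pos_pos add_pos_nonneg) auto
  finally have le: "(1 - 2 * p) ^ w \<le> 1 / (1 + ?x)" .
  show ?thesis
  proof (cases "?x \<le> 1")
    case True
    have x0: "0 \<le> ?x" using assms by simp
    have "?x * ?x \<le> 1 * ?x" using True x0 by (intro mult_right_mono) auto
    then have "1 / (1 + ?x) \<le> 1 - ?x / 2"
      using x0 by (subst pos_divide_le_eq) (auto simp: algebra_simps)
    with le have "?b \<le> 1 - p * w / 2" by simp
    also have "\<dots> \<le> exp (- (p * w / 2))"
      using exp_ge_add_one_self[of "- (p * w / 2)"] by simp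
    finally have "?b ^ m \<le> exp (- (p * w / 2)) ^ m"
      using b0 by (intro power_mono)
    also have "\<dots> = exp (- (p * m / 2)) ^ w"
      by (simp add: exp_of_nat_mult[symmetric] mult_ac)
    finally show ?thesis by (simp add: add_increasing2)
  next
    case False
    then have "1 / (1 + ?x) \<le> 1 / 2" by (intro divide_left_mono) auto
    with le have "?b \<le> 3 / 4" by simp
    then have "?b ^ m \<le> (3/4) ^ m" using b0 by (intro power_mono)
    then show ?thesis by (simp add: add_increasing)
  qed
qed

text \<open>\<open>D\<close> is the set where two close solutions differ. Both satisfy the same
  clause with the same constant, so their counts of true variables in it have equal parity.\<close>

lemma not_separated_imp_even_set:
  assumes "\<not> separated n d F" "\<forall>C\<in>set F. snd C \<subseteq> {1..n}"
  shows "\<exists>D\<in>Pow {1..n} - {{}}. real (card D) < d \<and> (\<forall>C\<in>set F. even (card (snd C \<inter> D)))"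
proof -
  obtain a b where ab: "a \<in> solutions n F" "b \<in> solutions n F" "a \<noteq> b" "real (hamming_dist n a b) < d"
    using assms(1) by (auto simp: separated_def not_le)
  let ?D = "{i\<in>{1..n}. a i \<noteq> b i}"
  have "?D \<noteq> {}"
  proof
    assume "?D = {}"
    then have "a = b"
      using ab(1,2) by (intro PiE_ext[of a "{1..n}" "\<lambda>_. UNIV" b])
        (auto simp: solutions_def assignments_def)
    with ab(3) show False by simp
  qed
  moreover have "even (card (snd C \<inter> ?D))" if C: "C \<in> set F" for C
  proof -
    obtain c V where [simp]: "C = (c, V)" by (cases C)
    have V: "V \<subseteq> {1..n}" using assms(2) C by force
    have "sat_clause a C" "sat_clause b C" using ab C by (auto simp: solutions_def)
    then have "even (card {i\<in>V. a i}) \<longleftrightarrow> even (card {i\<in>V. b i})" by (auto split: if_splits)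
    then have "even (card {i\<in>V. a i \<noteq> b i})"
      using finite_subset[OF V] by (intro even_card_neq) auto
    also have "{i\<in>V. a i \<noteq> b i} = snd C \<inter> ?D" using V by auto
    finally show ?thesis .
  qed
  ultimately show ?thesis
    using ab(4) by (intro bexI[of _ ?D]) (auto simp: hamming_dist_def)
qed

lemma set_random_xor_formula:
  assumes "F \<in> set_pmf (random_xor_formula p n x)" "C \<in> set F"
  shows "snd C \<subseteq> {1..n}"
  using assms by (fastforce simp: random_xor_formula_def set_replicate_pmf random_xor_clause_def random_var_set_def)

text \<open>Union bound over the difference sets, with the two terms of
  \<open>even_prob_bound\<close> summed separately. The parameter \<open>y\<close> is left free, to
  be tuned against (3/4)^m later.\<close>

lemma prob_not_separated_le:
  fixes p d x y :: real
  assumes "0 \<le> p" "p \<le> 1/2" "0 < y" "y \<le> 1"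
  defines "m \<equiv> nat \<lceil>x\<rceil>"
  shows "measure_pmf.prob (random_xor_formula p n x) {F. \<not> separated n d F}
           \<le> ((1 + exp (- (p * m / 2))) ^ n - 1) + (3/4) ^ m * ((1 + y) ^ n * y powr (- d))"
proof -
  let ?M = "random_xor_formula p n x"
  let ?S = "{D \<in> Pow {1..n} - {{}}. real (card D) < d}"
  let ?E = "\<lambda>D. {F :: xor_formula. \<forall>C\<in>set F. even (card (snd C \<inter> D))}"
  let ?q = "exp (- (p * m / 2))"
  have fin: "finite ?S" by simp
  have "measure_pmf.prob ?M {F. \<not> separated n d F} \<le> measure_pmf.prob ?M (\<Union>D\<in>?S. ?E D)"
  \<comment> \<open>The inclusion is needed only on the support, where all clause variables lie in
    {1..n}.\<close>
  proof (rule measure_pmf.finite_measure_mono_AE)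
    show "AE F in ?M. F \<in> {F. \<not> separated n d F} \<longrightarrow> F \<in> (\<Union>D\<in>?S. ?E D)"
      unfolding AE_measure_pmf_iff
    proof (intro ballI impI)
      fix F assume F: "F \<in> set_pmf ?M" "F \<in> {F. \<not> separated n d F}"
      then obtain D where "D \<in> Pow {1..n} - {{}}" "real (card D) < d" "F \<in> ?E D"
        using not_separated_imp_even_set[of n d F] set_random_xor_formula[OF F(1)] by blast
      then show "F \<in> (\<Union>D\<in>?S. ?E D)" by blast
    qed
  qed simp
  also have "\<dots> \<le> (\<Sum>D\<in>?S. measure_pmf.prob ?M (?E D))"
    by (intro measure_pmf.finite_measure_subadditive_finite fin) auto
  also have "\<dots> \<le> (\<Sum>D\<in>?S. ?q ^ card D + (3/4) ^ m)"
  proof (intro sum_mono)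
    fix D assume "D \<in> ?S"
    then have "D \<subseteq> {1..n}" by auto
    then have "measure_pmf.prob ?M (?E D) = ((1 + (1 - 2 * p) ^ card D) / 2) ^ m"
      unfolding random_xor_formula_def prob_replicate_pmf_all m_def
      using assms(1,2) by (simp add: prob_clause_even)
    then show "measure_pmf.prob ?M (?E D) \<le> ?q ^ card D + (3/4) ^ m"
      using even_prob_bound[OF assms(1,2)] by simp
  qed
  also have "\<dots> = (\<Sum>D\<in>?S. ?q ^ card D) + (3/4) ^ m * (\<Sum>D\<in>?S. 1)"
    by (simp add: sum.distrib)
  also have "(\<Sum>D\<in>?S. ?q ^ card D) \<le> (\<Sum>D\<in>Pow {1..n} - {{}}. ?q ^ card D)"
    by (intro sum_mono2) auto
  also have "\<dots> = (1 + ?q) ^ n - 1"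
    using sum_Pow_power_card[of "{1..n}" ?q] by (simp add: sum_diff)
  also \<comment> \<open>Chernoff-style count of the sets of size less than \<open>d\<close>, with weight \<open>y\<close> per element\<close>
    have "(\<Sum>D\<in>?S. 1) \<le> (\<Sum>D\<in>?S. y ^ card D * y powr (- d))"
  proof (intro sum_mono)
    fix D assume "D \<in> ?S"
    then have "y powr d \<le> y powr real (card D)"
      using assms by (intro powr_mono') auto
    then show "1 \<le> y ^ card D * y powr (- d)"
      using assms by (simp add: powr_realpow powr_minus field_simps)
  qed
  also have "\<dots> \<le> (\<Sum>D\<in>Pow {1..n}. y ^ card D * y powr (- d))"
    using assms by (intro sum_mono2) auto
  also have "\<dots> = (1 + y) ^ n * y powr (- d)"
    using sum_Pow_power_card[of "{1..n}" y] by (simp flip: sum_distrib_right)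
  finally show ?thesis by (simp add: mult_left_mono)
qed

section \<open>Choice of the linear rate and asymptotics\<close>

lemma exists_entropy_rate:
  fixes b :: real
  assumes "0 < b" "b < 1"
  obtains y c where "0 < y" "y \<le> 1" "0 < c" "b * (1 + y) * y powr (- c) < 1"
proof -
  \<comment> \<open>With this \<open>y\<close>, 1 - b(1 + y) = (1 - b)(2 - b)/2, which is
    positive.\<close>
  define y where "y = (1 - b) / 2"
  define r where "r = b * (1 + y)"
  have y: "0 < y" "y < 1" using assms by (auto simp: y_def)
  have "0 < (1 - b) * (2 - b)" using assms by simp
  then have r: "0 < r" "r < 1" using assms by (auto simp: r_def y_def field_simps)
  \<comment> \<open>Chosen so that y^(-c) = r^(-1/2), which makes the product the square root of
    \<open>r\<close>.\<close>
  define c where "c = ln r / (2 * ln y)"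
  have "0 < c" using r y by (auto simp: c_def intro!: divide_neg_neg)
  moreover have "r * y powr (- c) < 1"
  proof -
    have "r * y powr (- c) = exp (ln r) * exp (- ln r / 2)"
      using r y by (simp add: powr_def c_def)
    also have "\<dots> = exp (ln r / 2)" by (simp flip: exp_add)
    also have "\<dots> < 1" using r by simp
    finally show ?thesis .
  qed
  ultimately show ?thesis using y by (intro that[of y c]) (simp_all add: r_def)
qed

theorem theorem2:
  fixes s \<rho> :: real and f :: "nat \<Rightarrow> real"
  assumes "0 < s" and "s < 1" and "\<rho> > 2"
    and "\<And>n. n \<ge> 1 \<Longrightarrow> f n \<ge> 0"
    and "\<forall>\<^sub>F n in sequentially.
           \<rho> * (ln (s * real n) / (s * real n)) \<le> f n \<and> f n \<le> 1 / 2"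
  shows "\<exists>g :: nat \<Rightarrow> real. linear_lower_bound g \<and>
           (\<lambda>n. measure_pmf.prob (random_xor_formula (f n) n (s * real n)) {F. separated n (g n) F})
             \<longlonglongrightarrow> 1"
proof -
  \<comment> \<open>Since there are at least sn clauses, (3/4)^m \<le> b^n.\<close>
  define b where "b = (3/4 :: real) powr s"
  have b: "0 < b" "b < 1"
    using assms(1) powr_less_mono2[of s "3/4" 1] by (auto simp: b_def)
  obtain y c where y: "0 < y" "y \<le> 1" and c: "0 < c" and less1: "b * (1 + y) * y powr (- c) < 1"
    by (rule exists_entropy_rate[OF b])
  define r where "r = b * (1 + y) * y powr (- c)"
  have r0: "0 \<le> r" using b y by (simp add: r_def)
  define P where "P = (\<lambda>n. measure_pmf.prob (random_xor_formula (f n) n (s * real n)) {F. \<not> separated n (c * n) F})"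
  define B where "B = (\<lambda>n::nat. (exp (n * (s * n) powr (- (\<rho> / 2))) - 1) + r ^ n)"
  have bound: "\<forall>\<^sub>F n in sequentially. P n \<le> B n"
    using assms(5) eventually_ge_at_top[of 1]
  proof eventually_elim
    case (elim n)
    let ?m = "nat \<lceil>s * n\<rceil>"
    have sn: "0 < s * n" using elim assms by simp
    have m: "s * n \<le> ?m" by linarith
    have f0: "0 \<le> f n" using assms(4) elim by simp
    \<comment> \<open>The assumed lower bound on \<open>f\<close>; rounding the number of clauses up
      only increases the right side.\<close>
    have "\<rho> * ln (s * n) \<le> f n * (s * n)"
      using elim sn by (simp add: field_simps)
    also have "\<dots> \<le> f n * ?m" using m f0 by (rule mult_left_mono)
    finally have "exp (- (f n * ?m / 2)) \<le> exp (- (\<rho> * ln (s * n) / 2))" by simp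
    also have "\<dots> = (s * n) powr (- (\<rho> / 2))"
      using elim assms(1) unfolding powr_def by simp
    finally have q: "exp (- (f n * ?m / 2)) \<le> (s * n) powr (- (\<rho> / 2))" .
    have "(1 + exp (- (f n * ?m / 2))) ^ n \<le> exp ((s * n) powr (- (\<rho> / 2))) ^ n"
    proof (intro power_mono)
      show "1 + exp (- (f n * ?m / 2)) \<le> exp ((s * n) powr (- (\<rho> / 2)))"
        using q exp_ge_add_one_self[of "(s * n) powr (- (\<rho> / 2))"] by linarith
    qed (simp add: add_nonneg_nonneg)
    also have "\<dots> = exp (n * (s * n) powr (- (\<rho> / 2)))"
      by (simp add: exp_of_nat_mult)
    finally have 1: "(1 + exp (- (f n * ?m / 2))) ^ n - 1 \<le> exp (n * (s * n) powr (- (\<rho> / 2))) - 1"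
      by simp
    have "(3/4 :: real) ^ ?m = (3/4) powr ?m" by (simp add: powr_realpow)
    also have "\<dots> \<le> (3/4) powr (s * n)" using m by (intro powr_mono') auto
    also have "\<dots> = b ^ n" by (simp add: b_def powr_power mult.commute)
    finally have "(3/4 :: real) ^ ?m * ((1 + y) ^ n * y powr (- (c * n)))
        \<le> b ^ n * ((1 + y) ^ n * y powr (- (c * n)))"
      using y by (intro mult_right_mono) auto
    also have "\<dots> = r ^ n"
      using y by (simp add: r_def power_mult_distrib powr_power mult.commute)
    finally have 2: "(3/4 :: real) ^ ?m * ((1 + y) ^ n * y powr (- (c * n))) \<le> r ^ n" .
    have "f n \<le> 1 / 2" using elim by simp
    from prob_not_separated_le[OF f0 this y, of n "s * n" "c * n"] 1 2
    show ?case unfolding P_def B_def by linarith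
  qed
  \<comment> \<open>The order is n^(1 - \<rho>/2), whose exponent is negative exactly because \<rho>
    > 2.\<close>
  have "(\<lambda>n::nat. n * (s * n) powr (- (\<rho> / 2))) \<longlonglongrightarrow> 0"
    using assms(1,3) by real_asymp
  then have "B \<longlonglongrightarrow> (exp 0 - 1) + 0"
    unfolding B_def using less1 r0 by (intro tendsto_intros LIMSEQ_realpow_zero) (auto simp: r_def)
  then have "P \<longlonglongrightarrow> 0"
    by (intro tendsto_sandwich[OF _ bound tendsto_const]) (auto simp: P_def)
  then have "(\<lambda>n. 1 - P n) \<longlonglongrightarrow> 1 - 0"
    by (intro tendsto_intros)
  moreover have "1 - P n
      = measure_pmf.prob (random_xor_formula (f n) n (s * real n)) {F. separated n (c * n) F}" for n
    by (simp add: P_def prob_Collect_eq_pmf_map pmf_map_not)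
  ultimately have "(\<lambda>n. measure_pmf.prob (random_xor_formula (f n) n (s * real n))
      {F. separated n (c * n) F}) \<longlonglongrightarrow> 1"
    by simp
  moreover have "linear_lower_bound (\<lambda>n. c * n)"
    using c by (auto simp: linear_lower_bound_def)
  ultimately show ?thesis by blast
qed

end
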